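(* Let $-\infty\le a_-<0<a_+\le\infty$ and $I:=\mathbb R\cap[a_-,a_+]$. Take any function $\mathsf s\colon[0,\infty]\to[-\infty,\infty]$ and any non-atomic finite nonnegative measure $\nu$ on $\mathcal B(\mathbb R)$. Then the following two conditions are equivalent to each other: (I) there exists a non-atomic zero-mean probability measure $\mu$ on $\mathcal B(\mathbb R)$ such that $\operatorname{supp}\mu=I$, $\mu_+=\nu$, and the restriction of $\mathsf r_\mu$ to $[0,\infty]$ equals $\mathsf s$; (II) all of the following conditions hold: - $\mathsf s(0)=0$; - $\nu\big((-\infty,0)\big)=0$; - $m_\nu:=G_\nu(\infty)<\infty$; - $\displaystyle\int_{(0,\infty)}\Big(1-\frac x{\mathsf s(x)}\Big)\,\nu(dx)=1$; - $\mathsf s$ is strictly decreasing on $[0,a_+]$; - $\mathsf s$ is continuous on $[0,\infty]$; - $\operatorname{supp}\nu=I_+:=\mathbb R\cap[0,a_+]$; - $\mathsf s=a_-$ on $[a_+,\infty]$. Moreover, under condition (II), the measure $\mu$ as in (I) is unique.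
   Context: $\mathcal B(\mathbb R)$ is the Borel $\sigma$-algebra; $\operatorname{supp}\nu$ is the set of all $x\in\mathbb R$ each of whose open neighborhoods has positive $\nu$-measure. A probability measure $\mu$ on $\mathcal B(\mathbb R)$ is zero-mean if $\int|x|\,\mu(dx)<\infty$ and $\int x\,\mu(dx)=0$. $\mu_+(A):=\mu(A\cap[0,\infty))$ for $A\in\mathcal B(\mathbb R)$. Functions with values in $[-\infty,\infty]$ are continuous with respect to the usual topology of the extended line. In the integral, $\frac x{\mathsf s(x)}:=0$ if $\mathsf s(x)=-\infty$, and $-\frac x{\mathsf s(x)}:=\infty$ if $\mathsf s(x)=0$, $x>0$. For a finite nonnegative measure $\nu$ on $\mathcal B(\mathbb R)$ (extended to $[-\infty,\infty]$ by $\nu(\{\pm\infty\})=0$) define $G_\nu\colon[-\infty,\infty]\to[0,\infty]$ by $G_\nu(x)=\int_{(0,x]}z\,\nu(dz)$ for $x\in[0,\infty]$ and $G_\nu(x)=\int_{[x,0)}(-z)\,\nu(dz)$ for $x\in[-\infty,0]$. For a non-atomic zero-mean probability measure $\mu$, let $x_{+}(h)=\inf\{x\in[0,\infty]\colon G_\mu(x)\ge h\}$ and $x_{-}(h)=\sup\{x\in[-\infty,0]\colon G_\mu(x)\ge h\}$ (with $\inf\emptyset=\infty$, $\sup\emptyset=-\infty$); the reciprocating function $\mathsf r_\mu\colon[-\infty,\infty]\to[-\infty,\infty]$ of $\mu$ is $\mathsf r_\mu(x)=x_-(G_\mu(x))$ for $x\in[0,\infty]$ and $\mathsf r_\mu(x)=x_+(G_\mu(x))$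 for $x\in[-\infty,0]$. *)

theory Defs
  imports "HOL-Probability.Probability"
begin

definition nonatomic :: "'a measure \<Rightarrow> bool" where
  "nonatomic M \<longleftrightarrow>
     (\<forall>A\<in>sets M. 0 < emeasure M A \<longrightarrow>
        (\<exists>B\<in>sets M. B \<subseteq> A \<and> 0 < emeasure M B \<and> emeasure M B < emeasure M A))"

definition supp :: "real measure \<Rightarrow> real set" where
  "supp M = {x. \<forall>U. open U \<and> x \<in> U \<longrightarrow> 0 < emeasure M U}"

definition zero_mean :: "real measure \<Rightarrow> bool" where
  "zero_mean M \<longleftrightarrow> integrable M (\<lambda>x. x) \<and> (\<integral>x. x \<partial>M) = 0"

definition plus_part :: "real measure \<Rightarrow> real measure" where
  "plus_part M = measure_of UNIV (sets borel) (\<lambda>A. emeasure M (A \<inter> {0..}))"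

text \<open>\<open>measure_of\<close> returns the null measure on set functions that are not countably additive;
  that case does not arise here.\<close>

lemma emeasure_plus_part:
  assumes M: "sets M = sets (borel :: real measure)" and A: "A \<in> sets borel"
  shows "emeasure (plus_part M) A = emeasure M (A \<inter> {0..})"
proof -
  let ?D = "density M (indicator {0..})"
  have S: "{0..} \<in> sets M"
    unfolding M by simp
  have eq: "emeasure ?D B = emeasure M (B \<inter> {0..})" if "B \<in> sets borel" for B
  proof -
    have "emeasure ?D B = (\<integral>\<^sup>+x. indicator {0..} x * indicator B x \<partial>M)"
      using that S M by (intro emeasure_density) auto
    also have "\<dots> = (\<integral>\<^sup>+x. indicator (B \<inter> {0..}) x \<partial>M)"
      by (intro nn_integral_cong) (auto simp: indicator_def)
    also have "\<dots> = emeasure M (B \<inter> {0..})"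
      using that S M by (intro nn_integral_indicator) auto
    finally show ?thesis .
  qed
  have "plus_part M = measure_of UNIV (sets borel) (emeasure ?D)"
    unfolding plus_part_def
    by (rule measure_of_eq)
       (auto simp: eq sets.sigma_sets_eq[of "borel :: real measure", simplified])
  also have "\<dots> = ?D"
    using measure_of_of_measure[of ?D] M sets_eq_imp_space_eq[OF M] by simp
  finally show ?thesis
    using eq[OF A] by simp
qed

text \<open>The measure lives on the reals, so extending it to the extended line by giving
  mass zero to the infinite points amounts to integrating over the real points of
  \<open>(0,x]\<close> or \<open>[x,0)\<close>.\<close>

definition G :: "real measure \<Rightarrow> ereal \<Rightarrow> ennreal" where
  "G M x =
     (if 0 \<le> x then \<integral>\<^sup>+z\<in>{z. 0 < z \<and> ereal z \<le> x}. ennreal z \<partial>M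
      else \<integral>\<^sup>+z\<in>{z. x \<le> ereal z \<and> z < 0}. ennreal (- z) \<partial>M)"

definition x_plus :: "real measure \<Rightarrow> ennreal \<Rightarrow> ereal" where
  "x_plus M h = Inf {x. 0 \<le> x \<and> h \<le> G M x}"

definition x_minus :: "real measure \<Rightarrow> ennreal \<Rightarrow> ereal" where
  "x_minus M h = Sup {x. x \<le> 0 \<and> h \<le> G M x}"

text \<open>At \<open>0\<close> the two defining formulas of the reciprocating function agree (both give \<open>0\<close>),
  as do those of \<open>G\<close>.\<close>

definition recip :: "real measure \<Rightarrow> ereal \<Rightarrow> ereal" where
  "recip M x = (if 0 \<le> x then x_minus M (G M x) else x_plus M (G M x))"

text \<open>The quotient \<open>x / y\<close> for \<open>x > 0\<close>, with the convention \<open>- x / 0 = \<infinity>\<close>;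
  the library's extended division would give \<open>x / 0 = \<infinity>\<close>.\<close>

definition quot :: "real \<Rightarrow> ereal \<Rightarrow> ereal" where
  "quot x y = (if y = - \<infinity> then 0 else if y = 0 then - \<infinity> else ereal x / y)"

text \<open>Integral of an extended-real function over a set, as the integral of the positive part
  minus that of the negative part (\<open>e2ennreal\<close> maps negative numbers to \<open>0\<close>).
  The undefined case \<open>\<infinity> - \<infinity>\<close> takes the value \<open>\<infinity>\<close>.\<close>

definition ext_integral :: "'a measure \<Rightarrow> 'a set \<Rightarrow> ('a \<Rightarrow> ereal) \<Rightarrow> ereal" where
  "ext_integral M A f =
     enn2ereal (\<integral>\<^sup>+x\<in>A. e2ennreal (f x) \<partial>M) - enn2ereal (\<integral>\<^sup>+x\<in>A. e2ennreal (- f x) \<partial>M)"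

text \<open>Functions on \<open>[0,\<infinity>]\<close> are modelled as total functions on \<open>ereal\<close>
  whose values at negative arguments are ignored.\<close>

definition represents ::
  "ereal \<Rightarrow> ereal \<Rightarrow> (ereal \<Rightarrow> ereal) \<Rightarrow> real measure \<Rightarrow> real measure \<Rightarrow> bool" where
  "represents a_minus a_plus s \<nu> \<mu> \<longleftrightarrow>
     sets \<mu> = sets borel \<and> prob_space \<mu> \<and> nonatomic \<mu> \<and> zero_mean \<mu> \<and>
     supp \<mu> = {x. a_minus \<le> ereal x \<and> ereal x \<le> a_plus} \<and>
     plus_part \<mu> = \<nu> \<and>
     (\<forall>x\<in>{0..\<infinity>}. recip \<mu> x = s x)"

definition admissible ::
  "ereal \<Rightarrow> ereal \<Rightarrow> (ereal \<Rightarrow> ereal) \<Rightarrow> real measure \<Rightarrow> bool" where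
  "admissible a_minus a_plus s \<nu> \<longleftrightarrow>
     s 0 = 0 \<and>
     emeasure \<nu> {..<0} = 0 \<and>
     G \<nu> \<infinity> < \<infinity> \<and>
     ext_integral \<nu> {0<..} (\<lambda>x. 1 - quot x (s (ereal x))) = 1 \<and>
     strict_antimono_on {0..a_plus} s \<and>
     continuous_on {0..\<infinity>} s \<and>
     supp \<nu> = {x. 0 \<le> x \<and> ereal x \<le> a_plus} \<and>
     (\<forall>x\<in>{a_plus..\<infinity>}. s x = a_minus)"

end

theory Submission
  imports Defs
begin

text \<open>
  On the positive and the negative half-line let \<open>\<mu>\<close> be reweighted by \<open>\<bar>z\<bar>\<close>. Then \<open>G\<close> is the
  distribution function of each of the two resulting measures, counted from \<open>0\<close> outwards, zero mean
  says that they have the same total mass, and \<open>x\<close> and \<open>s x\<close> cut off equal masses. Hence the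
  reciprocating function transports the positive half onto the negative half, so that \<open>\<mu>\<close> is
  recovered from \<open>\<nu>\<close> and \<open>s\<close> as \<open>\<nu>\<close> plus the transported measure divided by \<open>\<bar>z\<bar>\<close>.
  The mass of that sum is the integral of \<open>1 - x / s x\<close>. Conversely, any continuous strictly
  decreasing \<open>s\<close> as in (II) can be used for the transport, and the glued measure has \<open>s\<close> as its
  reciprocating function.
\<close>

subsection \<open>Non-atomic measures on the line and the function \<open>G\<close>\<close>

lemma nonatomic_singleton:
  assumes "nonatomic M" and "{x} \<in> sets M"
  shows "emeasure M {x} = 0"
proof (rule ccontr)
  assume "emeasure M {x} \<noteq> 0"
  then obtain B where "B \<subseteq> {x}" "0 < emeasure M B" "emeasure M B < emeasure M {x}"
    using assms unfolding nonatomic_def by (metis not_gr_zero)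
  then show False by (auto simp: subset_singleton_iff)
qed

text \<open>Without point masses the distribution function of \<open>M\<close> restricted to
  \<open>A\<close> is continuous, so by the intermediate value theorem some half-line cuts off
  exactly half of the mass of \<open>A\<close>.\<close>

lemma nonatomicI_singleton:
  fixes M :: "real measure"
  assumes sets: "sets M = sets borel" and fin: "finite_measure M"
    and null: "\<And>x. emeasure M {x} = 0"
  shows "nonatomic M"
  unfolding nonatomic_def
proof (intro ballI impI)
  fix A assume A: "A \<in> sets M" and pos: "0 < emeasure M A"
  interpret finite_measure M by (rule fin)
  define N where "N = density M (indicator A)"
  have N: "emeasure N B = emeasure M (A \<inter> B)" if "B \<in> sets borel" for B
    unfolding N_def using that A sets by (simp add: emeasure_density nn_integral_indicator
      flip: indicator_inter_arith)
  have fN: "finite_borel_measure N"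
  proof (intro finite_borel_measure.intro finite_measureI)
    show "emeasure N (space N) \<noteq> \<infinity>"
      using N[of "space N"] by (simp add: N_def sets_eq_imp_space_eq[OF sets] emeasure_eq_measure)
    show "finite_borel_measure_axioms N"
      by standard (simp add: N_def sets)
  qed
  interpret N: finite_borel_measure N by fact
  have mN: "measure N B = measure M (A \<inter> B)" if "B \<in> sets borel" for B
    using N[OF that] by (simp add: measure_def)
  have cont: "isCont (cdf N) x" for x
  proof -
    have "emeasure M (A \<inter> {x}) \<le> emeasure M {x}"
      by (rule emeasure_mono) (auto simp: sets)
    then show ?thesis
      unfolding N.isCont_cdf using mN[of "{x}"] null[of x] by (simp add: measure_def)
  qed
  have m: "measure M A > 0" using pos by (simp add: emeasure_eq_measure)
  have tot: "measure N (space N) = measure M A"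
    using mN[of UNIV] N.borel_UNIV by simp
  obtain b where b: "cdf N b > measure M A / 2"
    using order_tendstoD(1)[OF N.cdf_lim_at_top, of "measure M A / 2"] m
    by (auto simp: tot eventually_at_top_linorder)
  obtain a where a: "cdf N a < measure M A / 2"
    using order_tendstoD(2)[OF N.cdf_lim_at_bot, of "measure M A / 2"] m
    by (auto simp: eventually_at_bot_linorder)
  have "a \<le> b" using a b N.cdf_nondecreasing[of b a] by linarith
  then obtain x where x: "cdf N x = measure M A / 2"
    using IVT'[of "cdf N" a "measure M A / 2" b] a b cont
    by (auto simp: continuous_at_imp_continuous_on)
  have "measure M (A \<inter> {..x}) = measure M A / 2"
    using x mN[of "{..x}"] by (simp add: cdf_def2)
  then show "\<exists>B\<in>sets M. B \<subseteq> A \<and> 0 < emeasure M B \<and> emeasure M B < emeasure M A"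
    using m A sets by (intro bexI[of _ "A \<inter> {..x}"]) (auto simp: emeasure_eq_measure ennreal_lessI)
qed

lemma emeasure_eq_0_if_AE_notin:
  assumes "AE x in M. x \<notin> A"
  shows "emeasure M A = 0"
  using assms AE_iff_null_sets[of A M] by (cases "A \<in> sets M") (auto simp: emeasure_notin_sets)

text \<open>The complement of the support is the union of all open null sets, and by the Lindelof
  property countably many of them already cover it.\<close>

lemma AE_supp:
  assumes sets: "sets M = sets (borel :: real measure)"
  shows "AE x in M. x \<in> supp M"
proof -
  let ?F = "{U :: real set. open U \<and> emeasure M U = 0}"
  obtain F where F: "F \<subseteq> ?F" "countable F" "\<Union>F = \<Union>?F"
    using Lindelof[of ?F] by auto
  have "{x. x \<notin> supp M} = \<Union>F"
    unfolding F(3) by (auto simp: supp_def)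
  moreover have "\<Union>F \<in> null_sets M"
    using F by (intro null_sets_UN'[of F "\<lambda>x. x", simplified]) (auto simp: sets null_sets_def)
  ultimately show ?thesis
    by (intro AE_I'[of "\<Union>F"]) auto
qed

text \<open>Since \<open>ennreal\<close> sends negative numbers to \<open>0\<close>, the condition
  \<open>0 < z\<close> can be absorbed into the integrand. This leaves one fixed integrand over a
  growing half-line.\<close>

lemma G_nonneg_eq:
  assumes "0 \<le> x"
  shows "G M x = (\<integral>\<^sup>+z. ennreal z * indicator {z. ereal z \<le> x} z \<partial>M)"
  using assms unfolding G_def
  by (auto intro!: nn_integral_cong split: split_indicator simp: ennreal_neg)

lemma G_nonpos_eq:
  assumes "x \<le> 0"
  shows "G M x = (\<integral>\<^sup>+z. ennreal (- z) * indicator {z. x \<le> ereal z} z \<partial>M)"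
proof (cases "x = 0")
  \<comment> \<open>At \<open>0\<close> the definition uses the formula for the other side; both
    integrals vanish there.\<close>
  case True
  have "(\<integral>\<^sup>+z. ennreal (- z) * indicator {z. 0 \<le> z} z \<partial>M) = 0"
    by (auto intro!: nn_integral_zero' AE_I2 split: split_indicator simp: ennreal_neg)
  moreover have "(\<integral>\<^sup>+z. ennreal z * indicator {z. 0 < z \<and> z \<le> 0} z \<partial>M) = 0"
    by (auto intro!: nn_integral_zero' AE_I2 split: split_indicator)
  ultimately show ?thesis by (simp add: G_def True)
next
  case False
  then show ?thesis using assms unfolding G_def
    by (auto intro!: nn_integral_cong split: split_indicator simp: ennreal_neg)
qed

lemma G_0 [simp]: "G M 0 = 0"
  by (auto simp: G_def intro!: nn_integral_zero' AE_I2 split: split_indicator)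

lemma G_inf: "G M \<infinity> = (\<integral>\<^sup>+z. ennreal z \<partial>M)" "G M (-\<infinity>) = (\<integral>\<^sup>+z. ennreal (- z) \<partial>M)"
  by (simp_all add: G_nonneg_eq G_nonpos_eq)

lemma G_mono: "0 \<le> x \<Longrightarrow> x \<le> y \<Longrightarrow> G M x \<le> G M y"
  by (auto simp: G_nonneg_eq intro!: nn_integral_mono split: split_indicator)

lemma G_antimono: "y \<le> 0 \<Longrightarrow> x \<le> y \<Longrightarrow> G M y \<le> G M x"
  by (auto simp: G_nonpos_eq intro!: nn_integral_mono split: split_indicator)

text \<open>Dominated convergence: the integrands converge at every point except possibly the limit
  \<open>a\<close> itself, which is a null set.\<close>

lemma continuous_on_G_nonneg:
  assumes sets[measurable_cong]: "sets M = sets borel" and null: "\<And>x. emeasure M {x} = 0"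
    and fin: "G M \<infinity> < \<infinity>"
  shows "continuous_on {0..} (G M)"
proof (rule continuous_on_sequentiallyI)
  fix u a assume u: "\<forall>n. u n \<in> {0..}" and a: "a \<in> {0::ereal..}" and lim: "u \<longlonglongrightarrow> a"
  have "(\<lambda>n. \<integral>\<^sup>+z. ennreal z * indicator {z. ereal z \<le> u n} z \<partial>M)
      \<longlonglongrightarrow> (\<integral>\<^sup>+z. ennreal z * indicator {z. ereal z \<le> a} z \<partial>M)"
  proof (rule nn_integral_dominated_convergence[where w=ennreal])
    show "(\<integral>\<^sup>+z. ennreal z \<partial>M) < \<infinity>" using fin by (simp add: G_inf)
    \<comment> \<open>If \<open>a\<close> is infinite, \<open>real_of_ereal a\<close> is
      \<open>0\<close>, and the excluded point is harmless.\<close>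
    have "AE z in M. z \<noteq> real_of_ereal a"
      by (rule AE_I[of _ _ "{real_of_ereal a}"]) (auto simp: null sets)
    then show "AE z in M. (\<lambda>n. ennreal z * indicator {z. ereal z \<le> u n} z)
        \<longlonglongrightarrow> ennreal z * indicator {z. ereal z \<le> a} z"
    proof eventually_elim
      case (elim z)
      then consider "ereal z < a" | "ereal z > a" by (cases a) force+
      then have "eventually (\<lambda>n. indicator {z. ereal z \<le> u n} z = (indicator {z. ereal z \<le> a} z :: ennreal)) sequentially"
      proof cases
        case 1
        from order_tendstoD(1)[OF lim this] show ?thesis
          by eventually_elim (use 1 in auto)
      next
        case 2
        from order_tendstoD(2)[OF lim this] show ?thesis
          by eventually_elim (use 2 in auto)
      qed
      then have "eventually (\<lambda>n. ennreal z * indicator {z. ereal z \<le> u n} z = ennreal z * indicator {z. ereal z \<le> a} z) sequentially"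
        by eventually_elim simp
      then show ?case by (rule tendsto_eventually)
    qed
  qed (auto split: split_indicator)
  then show "(\<lambda>n. G M (u n)) \<longlonglongrightarrow> G M a"
    using u a by (simp add: G_nonneg_eq)
qed

section \<open>Reflection in the origin\<close>

definition reflect :: "real measure \<Rightarrow> real measure" where
  "reflect M = distr M borel uminus"

lemma sets_reflect [simp, measurable_cong]: "sets (reflect M) = sets borel"
  by (simp add: reflect_def)

lemma nn_integral_reflect:
  assumes "sets M = sets borel" "f \<in> borel_measurable borel"
  shows "(\<integral>\<^sup>+x. f x \<partial>reflect M) = (\<integral>\<^sup>+x. f (- x) \<partial>M)"
proof -
  have "uminus \<in> M \<rightarrow>\<^sub>M borel" unfolding measurable_cong_sets[OF assms(1) refl] by measurable
  then show ?thesis unfolding reflect_def by (rule nn_integral_distr) (use assms in simp)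
qed

lemma emeasure_reflect:
  assumes "sets M = sets borel" "A \<in> sets borel"
  shows "emeasure (reflect M) A = emeasure M (uminus ` A)"
proof -
  have "uminus \<in> M \<rightarrow>\<^sub>M borel" unfolding measurable_cong_sets[OF assms(1) refl] by measurable
  then have "emeasure (reflect M) A = emeasure M (uminus -` A \<inter> space M)"
    unfolding reflect_def by (rule emeasure_distr) fact
  also have "uminus -` A \<inter> space M = uminus ` A"
    using sets_eq_imp_space_eq[OF assms(1)] by (force simp: image_iff)
  finally show ?thesis .
qed

lemma reflect_reflect:
  assumes "sets M = sets borel"
  shows "reflect (reflect M) = M"
proof -
  have "(\<lambda>x. x) \<in> M \<rightarrow>\<^sub>M (borel :: real measure)"
    unfolding measurable_cong_sets[OF assms refl] by measurable
  then have "reflect (reflect M) = distr M borel (\<lambda>x. x)"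
    unfolding reflect_def by (subst distr_distr) (auto simp: comp_def)
  also have "\<dots> = M"
    using distr_id2[of borel M] assms by simp
  finally show ?thesis .
qed

lemma G_reflect:
  assumes "sets M = sets borel"
  shows "G (reflect M) x = G M (- x)"
proof -
  have iff: "ereal (- z) \<le> x \<longleftrightarrow> - x \<le> ereal z" for z x
    by (cases x) auto
  have nn: "G (reflect M) x = G M (- x)" if "0 \<le> x" "sets M = sets borel" for M x
    using that by (auto simp: G_nonneg_eq G_nonpos_eq nn_integral_reflect iff
      intro!: nn_integral_cong split: split_indicator)
  show ?thesis
  proof (cases "0 \<le> x")
    case True then show ?thesis using nn assms by blast
  next
    case False
    \<comment> \<open>Reflection is an involution, so negative arguments reduce to the case above
      with \<open>reflect M\<close> in place of \<open>M\<close>.\<close>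
    have "reflect (reflect M) = M" by (rule reflect_reflect) fact
    then show ?thesis using nn[of "-x" "reflect M"] False assms by simp
  qed
qed

subsection \<open>The reciprocating function\<close>

lemma supp_reflect:
  assumes "sets M = sets borel"
  shows "supp (reflect M) = uminus ` supp M"
proof -
  have sub: "- x \<in> supp (reflect N)" if "x \<in> supp N" "sets N = sets borel" for x N
    unfolding supp_def
  proof (intro CollectI allI impI, elim conjE)
    fix U :: "real set" assume U: "open U" "- x \<in> U"
    have "open (uminus ` U)" using U by (simp add: open_negations)
    moreover have "x \<in> uminus ` U" using U by force
    ultimately have "0 < emeasure N (uminus ` U)" using that by (auto simp: supp_def)
    then show "0 < emeasure (reflect N) U" using emeasure_reflect[OF that(2), of U] U by simp
  qed
  show ?thesis
  proof
    show "uminus ` supp M \<subseteq> supp (reflect M)" using sub assms by auto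
    show "supp (reflect M) \<subseteq> uminus ` supp M"
    proof
      fix x assume "x \<in> supp (reflect M)"
      then have "- x \<in> supp M" using sub[of x "reflect M"] assms by (simp add: reflect_reflect)
      then show "x \<in> uminus ` supp M" by force
    qed
  qed
qed

text \<open>The open interval between \<open>x\<close> and \<open>y\<close> contains a support
  point, hence has positive mass, and the weight is positive on it.\<close>

lemma G_strict_mono:
  assumes sets[measurable_cong]: "sets M = sets borel" and fin: "G M \<infinity> < \<infinity>"
    and x: "0 \<le> x" "x < ereal z" "ereal z < y" and z: "z \<in> supp M"
  shows "G M x < G M y"
proof -
  let ?U = "{z. x < ereal z \<and> ereal z < y}"
  have "open ?U"
    by (intro open_Collect_conj open_Collect_less continuous_intros)
  then have U: "0 < emeasure M ?U" and [measurable]: "?U \<in> sets borel"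
    using z x by (auto simp: supp_def)
  have "(\<integral>\<^sup>+z. ennreal z * indicator ?U z \<partial>M) \<noteq> 0"
  proof
    assume "(\<integral>\<^sup>+z. ennreal z * indicator ?U z \<partial>M) = 0"
    then have "AE z in M. ennreal z * indicator ?U z = 0"
      by (subst (asm) nn_integral_0_iff_AE) auto
    then have "AE z in M. z \<notin> ?U"
    proof eventually_elim
      case (elim z)
      show ?case
      proof
        assume "z \<in> ?U"
        then have "0 < z" using order_le_less_trans[OF x(1), of "ereal z"] by simp
        with elim \<open>z \<in> ?U\<close> show False by (simp split: split_indicator_asm)
      qed
    qed
    then have "emeasure M ?U = 0"
      by (subst (asm) AE_iff_measurable[OF _ refl]) (auto simp: sets sets_eq_imp_space_eq[OF sets])
    with U show False by simp
  qed
  moreover have "G M x + (\<integral>\<^sup>+z. ennreal z * indicator ?U z \<partial>M) \<le> G M y"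
  proof -
    have "G M x + (\<integral>\<^sup>+z. ennreal z * indicator ?U z \<partial>M) =
        (\<integral>\<^sup>+z. ennreal z * indicator {z. ereal z \<le> x} z + ennreal z * indicator ?U z \<partial>M)"
      using x by (subst nn_integral_add) (auto simp: G_nonneg_eq)
    also have "\<dots> \<le> (\<integral>\<^sup>+z. ennreal z * indicator {z. ereal z \<le> y} z \<partial>M)"
      using x by (intro nn_integral_mono) (auto split: split_indicator)
    finally show ?thesis using x by (simp add: G_nonneg_eq)
  qed
  \<comment> \<open>Adding a nonzero amount gives a strictly larger value only when the first
    summand is finite.\<close>
  moreover have "G M x \<noteq> top"
    using G_mono[of x \<infinity> M] x fin by (auto simp: top_unique)
  moreover have "g < g + c" if "g \<noteq> top" "c \<noteq> 0" for g c :: ennreal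
    using that by (cases g; cases c) (auto simp: ennreal_less_iff simp flip: ennreal_plus)
  ultimately show ?thesis
    by (meson order_less_le_trans)
qed

lemma G_eq_beyond:
  assumes "AE z in M. ereal z \<le> a" "0 \<le> a" "a \<le> x"
  shows "G M x = G M a"
proof -
  have "AE z in M. ennreal z * indicator {z. ereal z \<le> x} z = ennreal z * indicator {z. ereal z \<le> a} z"
    using assms(1) by eventually_elim (use assms in \<open>auto split: split_indicator\<close>)
  then show ?thesis using assms by (simp add: G_nonneg_eq nn_integral_cong_AE)
qed

lemma G_strict_mono_on:
  assumes sets: "sets M = sets borel" and fin: "G M \<infinity> < \<infinity>"
    and supp: "{z. 0 \<le> z \<and> ereal z \<le> b} \<subseteq> supp M"
  shows "strict_mono_on {0..b} (G M)"
proof (rule strict_mono_onI)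
  fix x y assume xy: "x \<in> {0..b}" "y \<in> {0..b}" "x < y"
  obtain z where z: "x < ereal z" "ereal z < y" using ereal_dense2[OF xy(3)] by blast
  have "0 \<le> ereal z" "ereal z \<le> b"
    using z xy order_trans[of 0 x "ereal z"] order_trans[of "ereal z" y b] by auto
  then have "z \<in> supp M" using supp by auto
  then show "G M x < G M y" using G_strict_mono[OF sets fin _ z] xy by auto
qed

text \<open>Zero mean enters as \<open>G_balanced\<close> and \<open>G_finite\<close>, see
  \<open>zero_mean_iff_G\<close>. Total mass one is left out, so that the glued measure is an
  instance before its mass is known.\<close>

locale balanced_measure =
  fixes M :: "real measure" and a b :: ereal
  assumes sets_M: "sets M = sets borel"
    and singleton_null: "emeasure M {x} = 0"
    and G_balanced: "G M (-\<infinity>) = G M \<infinity>"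
    and G_finite: "G M \<infinity> < \<infinity>"
    and supp_M: "supp M = {x. a \<le> ereal x \<and> ereal x \<le> b}"
    and a_neg: "a < 0" and b_pos: "0 < b"
begin

text \<open>The assumptions are symmetric in the two half-lines, so each fact about \<open>G\<close>
  on the positive side has a mirror image on the negative side.\<close>

lemma reflected: "balanced_measure (reflect M) (- b) (- a)"
proof
  show "supp (reflect M) = {x. - b \<le> ereal x \<and> ereal x \<le> - a}"
  proof -
    have "ereal x \<le> - a \<longleftrightarrow> a \<le> ereal (- x)" "- b \<le> ereal x \<longleftrightarrow> ereal (- x) \<le> b" for x
      by (cases a; auto) (cases b; auto)
    then show ?thesis
      unfolding supp_reflect[OF sets_M] supp_M by (force simp: image_iff)
  qed
qed (use a_neg b_pos G_balanced G_finite singleton_null in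
  \<open>auto simp: sets_M emeasure_reflect G_reflect ereal_less_uminus_reorder ereal_uminus_less_reorder\<close>)

lemma continuous_G_pos: "continuous_on {0..} (G M)"
  using continuous_on_G_nonneg[OF sets_M singleton_null G_finite] .

lemma AE_le_b: "AE z in M. ereal z \<le> b"
  using AE_supp[OF sets_M] by eventually_elim (simp add: supp_M)

lemma G_above: "b \<le> x \<Longrightarrow> G M x = G M b"
  by (rule G_eq_beyond[OF AE_le_b]) (use b_pos in auto)

lemma strict_mono_G: "strict_mono_on {0..b} (G M)"
proof (rule G_strict_mono_on[OF sets_M G_finite])
  show "{z. 0 \<le> z \<and> ereal z \<le> b} \<subseteq> supp M"
    using a_neg order_trans[of a 0] by (auto simp: supp_M)
qed

interpretation R: balanced_measure "reflect M" "- b" "- a" by (rule reflected)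

lemma G_uminus: "G M y = G (reflect M) (- y)"
  by (simp add: G_reflect sets_M)

lemma continuous_G_neg: "continuous_on {..0} (G M)"
proof -
  have "continuous_on {..0} (\<lambda>y. G (reflect M) (- y))"
    by (rule continuous_on_compose2[OF R.continuous_G_pos]) (auto intro!: continuous_intros)
  then show ?thesis by (simp add: G_uminus)
qed

lemma G_below: "x \<le> a \<Longrightarrow> G M x = G M a"
  using R.G_above[of "- x"] by (simp add: G_uminus)

lemma strict_antimono_G: "strict_antimono_on {a..0} (G M)"
  using R.strict_mono_G unfolding monotone_on_def G_uminus by simp

text \<open>As \<open>G\<close> strictly decreases on \<open>[a,0]\<close>, it falls below the level
  \<open>G M x\<close> to the right of \<open>y\<close>. Hence \<open>y\<close> is the maximum of
  the set whose supremum defines \<open>recip M x\<close>; a competitor beyond \<open>y\<close> lies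
  automatically in \<open>[a,0]\<close>.\<close>

lemma recip_eqI:
  assumes "0 \<le> x" "a \<le> y" "y \<le> 0" "G M y = G M x"
  shows "recip M x = y"
proof -
  have "Sup {y. y \<le> 0 \<and> G M x \<le> G M y} = y"
  proof (rule cSup_eq_maximum)
    fix y' assume y': "y' \<in> {y. y \<le> 0 \<and> G M x \<le> G M y}"
    show "y' \<le> y"
    proof (rule ccontr)
      assume "\<not> y' \<le> y"
      then have "G M y' < G M y" using y' assms
        by (intro monotone_onD[OF strict_antimono_G]) auto
      then show False using y' assms by auto
    qed
  qed (use assms in auto)
  then show ?thesis using assms by (simp add: recip_def x_minus_def)
qed

lemma G_le_G_inf: "G M x \<le> G M \<infinity>"
  using G_mono[of x \<infinity> M] G_antimono[of x "-\<infinity>" M] G_balanced by (cases "0 \<le> x") auto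

lemma recip_props:
  assumes "0 \<le> x"
  shows "a \<le> recip M x" "recip M x \<le> 0" "G M (recip M x) = G M x"
proof -
  \<comment> \<open>On \<open>[a,0]\<close> the continuous function \<open>G\<close> runs from the
    total weighted mass down to \<open>0\<close>, so it attains the level
    \<open>G M x\<close>.\<close>
  have "\<exists>y. a \<le> y \<and> y \<le> 0 \<and> G M y = G M x"
  proof (rule IVT2')
    show "G M x \<le> G M a" using G_le_G_inf[of x] G_below[of "-\<infinity>"] G_balanced by simp
  qed (use a_neg continuous_G_neg in \<open>auto intro: continuous_on_subset\<close>)
  then obtain y where "a \<le> y" "y \<le> 0" "G M y = G M x" by blast
  with recip_eqI[OF assms] show "a \<le> recip M x" "recip M x \<le> 0" "G M (recip M x) = G M x" by auto
qed

lemma recip_0: "recip M 0 = 0"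
  by (rule recip_eqI) (use a_neg in auto)

text \<open>From \<open>b\<close> on \<open>G\<close> has its full value, and on the negative side
  the full value is attained at \<open>a\<close>.\<close>

lemma recip_above: "b \<le> x \<Longrightarrow> recip M x = a"
  by (rule recip_eqI) (use a_neg b_pos G_below[of "-\<infinity>"] G_above[of \<infinity>] G_above[of x] G_balanced in auto)

lemma strict_antimono_recip: "strict_antimono_on {0..b} (recip M)"
proof (rule monotone_onI)
  fix x y assume xy: "x \<in> {0..b}" "y \<in> {0..b}" "x < y"
  have lt: "G M x < G M y" using xy by (intro monotone_onD[OF strict_mono_G])
  show "recip M y < recip M x"
  proof (rule ccontr)
    assume "\<not> ?thesis"
    then have "G M (recip M y) \<le> G M (recip M x)"
      using recip_props[of x] recip_props[of y] xy by (intro G_antimono) auto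
    with lt recip_props[of x] recip_props[of y] xy show False by auto
  qed
qed

text \<open>\<open>recip M\<close> is \<open>G M\<close> followed by the inverse of
  \<open>G M\<close> on \<open>[a,0]\<close>, and a continuous injection on a compact set has a
  continuous inverse.\<close>

lemma continuous_recip: "continuous_on {0..\<infinity>} (recip M)"
proof -
  define h where "h = the_inv_into {a..0} (G M)"
  have inj: "inj_on (G M) {a..0}"
    using strict_antimono_G unfolding strict_antimono_iff_antimono by blast
  have h: "h (G M y) = y" if "y \<in> {a..0}" for y
    unfolding h_def by (rule the_inv_into_f_f[OF inj that])
  have img: "G M x \<in> G M ` {a..0}" "recip M x = h (G M x)" if "0 \<le> x" for x
    using recip_props[OF that] h[of "recip M x"] by (auto simp: image_iff intro!: bexI[of _ "recip M x"])
  \<comment> \<open>This includes \<open>a = -\<infinity>\<close>, because the extended line is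
    compact.\<close>
  have "compact {a..0}"
    using compact_Int_closed[OF compact_UNIV closed_atLeastAtMost] by simp
  then have "continuous_on (G M ` {a..0}) h"
    using h continuous_on_subset[OF continuous_G_neg] by (intro continuous_on_inv) auto
  then have "continuous_on {0..\<infinity>} (\<lambda>x. h (G M x))"
    by (rule continuous_on_compose2) (use img continuous_G_pos in \<open>auto intro: continuous_on_subset\<close>)
  then show ?thesis
    by (rule continuous_on_eq) (simp add: img)
qed

end

subsection \<open>Weighted halves of a measure\<close>

text \<open>\<open>ennreal\<close> vanishes on negative numbers, so this measure lives on the
  positive half-line; \<open>neg_mass\<close> is its counterpart on the negative one.\<close>

definition pos_mass :: "real measure \<Rightarrow> real measure" where
  "pos_mass M = density M (\<lambda>z. ennreal z)"

definition neg_mass :: "real measure \<Rightarrow> real measure" where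
  "neg_mass M = density M (\<lambda>z. ennreal (- z))"

lemma sets_pos_mass [simp, measurable_cong]: "sets (pos_mass M) = sets M"
  by (simp add: pos_mass_def)

lemma sets_neg_mass [simp, measurable_cong]: "sets (neg_mass M) = sets M"
  by (simp add: neg_mass_def)

context
  fixes M :: "real measure"
  assumes sets_borel[measurable_cong]: "sets M = sets borel"
begin

lemma space_borel: "space M = UNIV"
  using sets_eq_imp_space_eq[OF sets_borel] by simp

lemma G_pos_mass: "0 \<le> x \<Longrightarrow> G M x = emeasure (pos_mass M) {z. ereal z \<le> x}"
  unfolding pos_mass_def by (subst emeasure_density) (auto simp: G_nonneg_eq sets_borel)

lemma G_neg_mass: "x \<le> 0 \<Longrightarrow> G M x = emeasure (neg_mass M) {z. x \<le> ereal z}"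
  unfolding neg_mass_def by (subst emeasure_density) (auto simp: G_nonpos_eq sets_borel)

lemma plus_part_eq_density: "plus_part M = density M (indicator {0..})"
proof (rule measure_eqI)
  show s: "sets (plus_part M) = sets (density M (indicator {0..}))"
    using sets.sigma_sets_eq[of "borel :: real measure"] by (simp add: plus_part_def sets_borel)
  fix A assume "A \<in> sets (plus_part M)"
  then have A: "A \<in> sets borel" using s sets_borel by simp
  have "emeasure (density M (indicator {0..})) A = emeasure M (A \<inter> {0..})"
    using A by (subst emeasure_restricted) (auto simp: sets_borel Int_commute)
  then show "emeasure (plus_part M) A = emeasure (density M (indicator {0..})) A"
    using emeasure_plus_part[OF sets_borel A] by simp
qed

lemma G_plus_part: "0 \<le> x \<Longrightarrow> G (plus_part M) x = G M x"
  unfolding plus_part_eq_density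
  by (simp add: G_nonneg_eq, subst nn_integral_density)
    (auto intro!: nn_integral_cong split: split_indicator simp: ennreal_neg)

text \<open>\<open>G\<close> at the two infinite points gives the integrals of the positive and the
  negative part of the identity.\<close>

lemma zero_mean_iff_G: "zero_mean M \<longleftrightarrow> G M (-\<infinity>) = G M \<infinity> \<and> G M \<infinity> < \<infinity>"
proof
  assume "zero_mean M"
  then have int: "integrable M (\<lambda>x. x)" "(\<integral>x. x \<partial>M) = 0" by (auto simp: zero_mean_def)
  then have "G M \<infinity> \<noteq> \<infinity>" "G M (-\<infinity>) \<noteq> \<infinity>" "enn2real (G M \<infinity>) = enn2real (G M (-\<infinity>))"
    using real_lebesgue_integral_def[OF int(1)] by (auto simp: G_inf real_integrable_def)
  then show "G M (-\<infinity>) = G M \<infinity> \<and> G M \<infinity> < \<infinity>"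
    by (cases "G M \<infinity>"; cases "G M (-\<infinity>)") auto
next
  assume "G M (-\<infinity>) = G M \<infinity> \<and> G M \<infinity> < \<infinity>"
  moreover from this have "integrable M (\<lambda>x. x)"
    unfolding real_integrable_def G_inf[symmetric] by auto
  ultimately show "zero_mean M"
    by (simp add: zero_mean_def real_lebesgue_integral_def G_inf)
qed

text \<open>Dividing the weight \<open>- z\<close> out again restores \<open>M\<close> on the
  negative half-line, and on the nonnegative one the weight is already \<open>0\<close>. So
  \<open>plus_part M\<close> and \<open>neg_mass M\<close> determine \<open>M\<close>.\<close>

lemma emeasure_decompose:
  assumes A: "A \<in> sets borel"
  shows "emeasure M A =
    emeasure (plus_part M) A + emeasure (density (neg_mass M) (\<lambda>z. ennreal (1 / - z))) A"
proof -
  have "density (neg_mass M) (\<lambda>z. ennreal (1 / - z)) = density M (indicator {..<0})"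
    unfolding neg_mass_def
    by (subst density_density_eq)
      (auto intro!: density_cong split: split_indicator simp: ennreal_neg simp flip: ennreal_mult')
  moreover have "emeasure (density M (indicator {..<0})) A = emeasure M (A \<inter> {..<0})"
    using A by (subst emeasure_restricted) (auto simp: sets_borel Int_commute)
  moreover have "emeasure M A = emeasure M (A \<inter> {0..}) + emeasure M (A \<inter> {..<0})"
    using A by (subst plus_emeasure) (auto simp: sets_borel intro!: arg_cong[where f="emeasure M"])
  ultimately show ?thesis
    using emeasure_plus_part[OF sets_borel A] by simp
qed

end

section \<open>Sums of two measures\<close>

definition add_measure :: "'a measure \<Rightarrow> 'a measure \<Rightarrow> 'a measure" where
  "add_measure M N = measure_of (space M) (sets M) (\<lambda>A. emeasure M A + emeasure N A)"

lemma sets_add_measure [simp, measurable_cong]: "sets (add_measure M N) = sets M"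
  by (simp add: add_measure_def)

lemma emeasure_add_measure:
  assumes "sets N = sets M" "A \<in> sets M"
  shows "emeasure (add_measure M N) A = emeasure M A + emeasure N A"
  unfolding add_measure_def
proof (rule emeasure_measure_of_sigma)
  show "countably_additive (sets M) (\<lambda>A. emeasure M A + emeasure N A)"
  proof (rule countably_additiveI)
    fix A :: "nat \<Rightarrow> 'a set"
    assume A: "range A \<subseteq> sets M" "disjoint_family A"
    then have "(\<Sum>i. emeasure M (A i)) = emeasure M (\<Union>i. A i)"
      "(\<Sum>i. emeasure N (A i)) = emeasure N (\<Union>i. A i)"
      using assms(1) by (auto intro: suminf_emeasure)
    then show "(\<Sum>i. emeasure M (A i) + emeasure N (A i)) = emeasure M (\<Union>i. A i) + emeasure N (\<Union>i. A i)"
      by (simp add: suminf_add[symmetric])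
  qed
qed (use assms in \<open>auto simp: positive_def sets.sigma_algebra_axioms\<close>)

lemma nn_integral_add_measure:
  assumes sets: "sets N = sets M" and f: "f \<in> borel_measurable M"
  shows "(\<integral>\<^sup>+x. f x \<partial>add_measure M N) = (\<integral>\<^sup>+x. f x \<partial>M) + (\<integral>\<^sup>+x. f x \<partial>N)"
  using f
proof (induction rule: borel_measurable_induct)
  case (cong f g)
  have "space N = space M" "space (add_measure M N) = space M"
    using sets_eq_imp_space_eq[OF sets] sets_eq_imp_space_eq[OF sets_add_measure] by simp_all
  then have "(\<integral>\<^sup>+x. f x \<partial>K) = (\<integral>\<^sup>+x. g x \<partial>K)" if "K \<in> {M, N, add_measure M N}" for K
    using that cong(3) by (intro nn_integral_cong) auto
  with cong(4) show ?case by simp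
next
  case (set A)
  then show ?case using sets by (simp add: emeasure_add_measure)
next
  case (mult u c)
  moreover have "u \<in> borel_measurable N" "u \<in> borel_measurable (add_measure M N)"
    using mult sets by (simp_all cong: measurable_cong_sets)
  ultimately show ?case by (simp add: nn_integral_cmult distrib_left)
next
  case (add u v)
  moreover have "u \<in> borel_measurable N" "u \<in> borel_measurable (add_measure M N)"
    "v \<in> borel_measurable N" "v \<in> borel_measurable (add_measure M N)"
    using add sets by (simp_all cong: measurable_cong_sets)
  ultimately show ?case by (simp add: nn_integral_add ac_simps)
next
  case (seq U)
  have meas: "U i \<in> borel_measurable N" "U i \<in> borel_measurable (add_measure M N)" for i
    using seq sets by (simp_all cong: measurable_cong_sets)
  have "(\<integral>\<^sup>+x. (SUP i. U i) x \<partial>add_measure M N) = (SUP i. (\<integral>\<^sup>+x. U i x \<partial>M) + (\<integral>\<^sup>+x. U i x \<partial>N))"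
    using seq meas by (simp add: nn_integral_monotone_convergence_SUP image_comp)
  \<comment> \<open>Both sequences of integrals increase, so the supremum of the sums is the sum of
    the suprema.\<close>
  also have "\<dots> = (SUP i. \<integral>\<^sup>+x. U i x \<partial>M) + (SUP i. \<integral>\<^sup>+x. U i x \<partial>N)"
    using seq by (intro ennreal_SUP_add) (auto simp: incseq_def le_fun_def intro!: nn_integral_mono)
  also have "\<dots> = (\<integral>\<^sup>+x. (SUP i. U i) x \<partial>M) + (\<integral>\<^sup>+x. (SUP i. U i) x \<partial>N)"
    using seq meas by (simp add: nn_integral_monotone_convergence_SUP image_comp)
  finally show ?case .
qed

subsection \<open>Gluing a transported half\<close>

text \<open>Condition (II) without its integral equation, with non-atomicity in the form of null
  singletons. The integral equation enters only later, as the statement that the glued measure has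
  mass one.\<close>

locale decreasing_transport =
  fixes N :: "real measure" and a b :: ereal and s :: "ereal \<Rightarrow> ereal"
  assumes sets_N [measurable_cong]: "sets N = sets borel"
    and singleton_null: "emeasure N {x} = 0"
    and neg_null: "emeasure N {..<0} = 0"
    and G_finite: "G N \<infinity> < \<infinity>"
    and supp_N: "supp N = {x. 0 \<le> x \<and> ereal x \<le> b}"
    and a_neg: "a < 0" and b_pos: "0 < b"
    and s_0: "s 0 = 0"
    and s_antimono: "strict_antimono_on {0..b} s"
    and s_continuous: "continuous_on {0..\<infinity>} s"
    and s_above: "\<forall>x\<in>{b..\<infinity>}. s x = a"
begin

text \<open>The truncation \<open>max 0 x\<close> avoids the values of \<open>s\<close> at negative arguments, about which nothing
  is assumed.\<close>

definition real_s :: "real \<Rightarrow> real" where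
  "real_s x = real_of_ereal (s (ereal (max 0 x)))"

text \<open>Designed to be \<open>neg_mass\<close> of the measure under construction.\<close>

definition transported :: "real measure" where
  "transported = distr (pos_mass N) borel real_s"

lemma real_s_measurable [measurable]: "real_s \<in> borel_measurable borel"
proof -
  have "continuous_on UNIV (\<lambda>x::real. s (ereal (max 0 x)))"
    by (rule continuous_on_compose2[OF s_continuous])
      (auto intro!: continuous_intros simp: le_max_iff_disj)
  then have "(\<lambda>x::real. s (ereal (max 0 x))) \<in> borel_measurable borel"
    by (rule borel_measurable_continuous_onI)
  then show ?thesis unfolding real_s_def by measurable
qed

lemma sets_transported [simp, measurable_cong]: "sets transported = sets borel"
  by (simp add: transported_def)

lemma emeasure_transported:
  "A \<in> sets borel \<Longrightarrow> emeasure transported A = emeasure (pos_mass N) {x. real_s x \<in> A}"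
  unfolding transported_def
  by (subst emeasure_distr) (auto simp: pos_mass_def space_borel[OF sets_N] vimage_def)

text \<open>The support lies in \<open>[0,b]\<close> and the endpoints are null. For
  \<open>b = \<infinity>\<close> the second excluded point \<open>real_of_ereal b\<close> is
  \<open>0\<close> again.\<close>

lemma AE_N: "AE z in N. 0 < z \<and> ereal z < b"
proof -
  have "AE z in N. z \<noteq> c" for c
    by (rule AE_I[of _ _ "{c}"]) (auto simp: singleton_null sets_N)
  from AE_supp[OF sets_N] this[of 0] this[of "real_of_ereal b"] show ?thesis
    by eventually_elim (cases b, auto simp: supp_N)
qed

lemma AE_pos_mass: "AE z in pos_mass N. 0 < z \<and> ereal z < b"
  using AE_N unfolding pos_mass_def by (subst AE_density) auto

lemma s_b: "s b = a"
  using s_above by simp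

lemma s_less: "0 \<le> x \<Longrightarrow> x < y \<Longrightarrow> y \<le> b \<Longrightarrow> s y < s x"
  using monotone_onD[OF s_antimono, of x y] by auto

lemma s_le_iff: "x \<in> {0..b} \<Longrightarrow> y \<in> {0..b} \<Longrightarrow> s x \<le> s y \<longleftrightarrow> y \<le> x"
  using s_less[of x y] s_less[of y x] by (cases x y rule: linorder_cases) auto

text \<open>Strict decrease puts \<open>s\<close> strictly between \<open>s b = a\<close> and
  \<open>s 0 = 0\<close> here, so its value is finite and \<open>real_of_ereal\<close> loses
  nothing.\<close>

lemma real_s_bounds:
  assumes "0 < z" "ereal z < b"
  shows "ereal (real_s z) = s (ereal z)" "a < ereal (real_s z)" "real_s z < 0"
proof -
  have "a < s (ereal z)" "s (ereal z) < 0"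
    using s_less[of "ereal z" b] s_less[of 0 "ereal z"] assms by (auto simp: s_b s_0)
  then show "ereal (real_s z) = s (ereal z)" "a < ereal (real_s z)" "real_s z < 0"
    using assms a_neg by (cases "s (ereal z)"; auto simp: real_s_def)+
qed

text \<open>\<open>s\<close> is injective on \<open>(0,b)\<close>, so up to a null set the preimage
  of \<open>y\<close> has at most one point.\<close>

lemma emeasure_transported_singleton: "emeasure transported {y} = 0"
proof (cases "\<exists>x. 0 < x \<and> ereal x < b \<and> real_s x = y")
  case True
  then obtain x where x: "0 < x" "ereal x < b" "real_s x = y" by blast
  have "AE z in N. z \<noteq> x"
    by (rule AE_I[of _ _ "{x}"]) (auto simp: singleton_null sets_N)
  then have "AE z in pos_mass N. z \<noteq> x"
    unfolding pos_mass_def by (subst AE_density) auto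
  with AE_pos_mass have "AE z in pos_mass N. real_s z \<notin> {y}"
  proof eventually_elim
    case (elim z)
    then show ?case
      using s_less[of z x] s_less[of x z] real_s_bounds(1)[of x] real_s_bounds(1)[of z] x
        less_imp_le[of "ereal x" b] less_imp_le[of "ereal z" b]
      by (cases x z rule: linorder_cases) auto
  qed
  then show ?thesis
    by (subst emeasure_transported) (auto intro!: emeasure_eq_0_if_AE_notin)
next
  case False
  from AE_pos_mass have "AE z in pos_mass N. real_s z \<notin> {y}"
    by eventually_elim (use False in auto)
  then show ?thesis
    by (subst emeasure_transported) (auto intro!: emeasure_eq_0_if_AE_notin)
qed

lemma AE_transported: "AE y in transported. a < ereal y \<and> y < 0"
proof -
  have "AE z in pos_mass N. a < ereal (real_s z) \<and> real_s z < 0"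
    using AE_pos_mass by eventually_elim (use real_s_bounds(2,3) in blast)
  then show ?thesis
    unfolding transported_def by (subst AE_distr_iff) auto
qed

text \<open>\<open>s\<close> reverses the order, so up to a null set the preimage of the half-line
  from \<open>s x\<close> is the half-line up to \<open>x\<close>. Beyond \<open>b\<close> both
  sides are constant.\<close>

lemma emeasure_transported_atLeast:
  assumes "0 \<le> x"
  shows "emeasure transported {y. s x \<le> ereal y} = G N x"
proof -
  have *: "emeasure transported {y. s x \<le> ereal y} = G N x" if x: "x \<in> {0..b}" for x
  proof -
    have "emeasure transported {y. s x \<le> ereal y} = emeasure (pos_mass N) {z. s x \<le> ereal (real_s z)}"
      by (subst emeasure_transported) auto
    also have "\<dots> = emeasure (pos_mass N) {z. ereal z \<le> x}"
    proof (rule emeasure_eq_AE)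
      show "AE z in pos_mass N. z \<in> {z. s x \<le> ereal (real_s z)} \<longleftrightarrow> z \<in> {z. ereal z \<le> x}"
        using AE_pos_mass by eventually_elim (use x in \<open>auto simp: real_s_bounds s_le_iff\<close>)
    qed (auto simp: sets_N)
    also have "\<dots> = G N x" using x by (simp add: G_pos_mass[OF sets_N])
    finally show ?thesis .
  qed
  show ?thesis
  proof (cases "x \<le> b")
    case False
    have "AE z in N. ereal z \<le> b" using AE_N by eventually_elim auto
    then have "G N x = G N b" using False b_pos by (intro G_eq_beyond) auto
    moreover have "s x = s b" using False s_above s_b by auto
    ultimately show ?thesis using *[of b] b_pos by simp
  qed (use * assms in auto)
qed

lemma s_onto:
  assumes "a \<le> y" "y \<le> 0" obtains x where "x \<in> {0..b}" "s x = y"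
proof -
  have "\<exists>x. 0 \<le> x \<and> x \<le> b \<and> s x = y"
    by (rule IVT2') (use assms b_pos s_b s_0 s_continuous in \<open>auto intro: continuous_on_subset\<close>)
  then show ?thesis using that by auto
qed

definition mass_total :: ennreal where
  "mass_total = emeasure N UNIV + emeasure (density transported (\<lambda>z. ennreal (1 / - z))) UNIV"

text \<open>Almost everywhere \<open>s\<close> is finite and negative, so the integrand is
  \<open>1\<close> plus a nonnegative term and has no negative part. The \<open>1\<close> gives the
  mass of \<open>N\<close>; the other term, after the substitution \<open>y = s x\<close> under the
  weight \<open>x\<close>, gives the mass of the transported measure divided by
  \<open>- y\<close>.\<close>

lemma ext_integral_quot:
  "ext_integral N {0<..} (\<lambda>x. 1 - quot x (s (ereal x))) = enn2ereal mass_total"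
proof -
  \<comment> \<open>Neither special case of \<open>quot\<close> occurs on
    \<open>(0,b)\<close>.\<close>
  have quot: "quot z (s (ereal z)) = - ereal (z * (1 / - real_s z))" if "0 < z" "ereal z < b" for z
    unfolding real_s_bounds(1)[OF that, symmetric] quot_def using real_s_bounds(3)[OF that] by simp
  have nn: "0 \<le> z * (1 / - real_s z)" if "0 < z" "ereal z < b" for z
    using that real_s_bounds(3)[OF that] by (simp add: divide_nonneg_neg divide_nonneg_nonpos)
  have "(\<integral>\<^sup>+x\<in>{0<..}. e2ennreal (1 - quot x (s (ereal x))) \<partial>N) =
      (\<integral>\<^sup>+x. 1 + ennreal x * ennreal (1 / - real_s x) \<partial>N)"
  proof (rule nn_integral_cong_AE, use AE_N in eventually_elim)
    case (elim z)
    have "1 - quot z (s (ereal z)) = ereal (1 + z * (1 / - real_s z))"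
      using elim by (simp add: quot one_ereal_def)
    then have "e2ennreal (1 - quot z (s (ereal z))) = ennreal (1 + z * (1 / - real_s z))"
      by (simp add: ennreal.rep_eq e2ennreal_ereal)
    also have "\<dots> = 1 + ennreal (z * (1 / - real_s z))"
      using nn[of z] elim by (subst ennreal_plus) auto
    also have "\<dots> = 1 + ennreal z * ennreal (1 / - real_s z)"
      using elim by (subst ennreal_mult') auto
    finally show ?case using elim by simp
  qed
  also have "\<dots> = emeasure N UNIV + (\<integral>\<^sup>+x. ennreal x * ennreal (1 / - real_s x) \<partial>N)"
    by (subst nn_integral_add) (auto simp: space_borel[OF sets_N])
  also have "(\<integral>\<^sup>+x. ennreal x * ennreal (1 / - real_s x) \<partial>N) =
      emeasure (density transported (\<lambda>z. ennreal (1 / - z))) UNIV"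
    by (simp add: emeasure_density transported_def nn_integral_distr pos_mass_def nn_integral_density)
  finally have pos: "(\<integral>\<^sup>+x\<in>{0<..}. e2ennreal (1 - quot x (s (ereal x))) \<partial>N) = mass_total"
    by (simp add: mass_total_def)
  have "(\<integral>\<^sup>+x\<in>{0<..}. e2ennreal (- (1 - quot x (s (ereal x)))) \<partial>N) = (\<integral>\<^sup>+x. 0 \<partial>N)"
  proof (rule nn_integral_cong_AE, use AE_N in eventually_elim)
    case (elim z)
    have "- (1 - quot z (s (ereal z))) = ereal (- (1 + z * (1 / - real_s z)))"
      using elim by (simp add: quot one_ereal_def)
    also have "\<dots> \<le> 0" using nn[of z] elim by simp
    finally show ?case by (simp add: e2ennreal_neg)
  qed
  then show ?thesis by (simp add: ext_integral_def pos zero_ennreal.rep_eq)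
qed

end

section \<open>The glued measure and its reciprocating function\<close>

context decreasing_transport
begin

text \<open>The density needs no restriction to negative \<open>z\<close>: \<open>ennreal\<close> maps negative numbers to \<open>0\<close>,
  and \<open>1 / 0 = 0\<close>.\<close>

definition glued :: "real measure" where
  "glued = add_measure N (density transported (\<lambda>z. ennreal (1 / - z)))"

lemma sets_glued [simp, measurable_cong]: "sets glued = sets borel"
  by (simp add: glued_def sets_N)

lemma emeasure_glued:
  "A \<in> sets borel \<Longrightarrow>
    emeasure glued A = emeasure N A + emeasure (density transported (\<lambda>z. ennreal (1 / - z))) A"
  unfolding glued_def by (rule emeasure_add_measure) (auto simp: sets_N)

lemma nn_integral_glued:
  assumes [measurable]: "f \<in> borel_measurable borel"
  shows "(\<integral>\<^sup>+x. f x \<partial>glued) = (\<integral>\<^sup>+x. f x \<partial>N) + (\<integral>\<^sup>+z. ennreal (1 / - z) * f z \<partial>transported)"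
  unfolding glued_def
  by (subst nn_integral_add_measure) (auto simp: sets_N nn_integral_density)

text \<open>The transported measure lives on negative numbers, where the density
  \<open>1 / - z\<close> is strictly positive.\<close>

lemma emeasure_transported_density_pos:
  assumes "A \<in> sets borel" "emeasure transported A \<noteq> 0"
  shows "emeasure (density transported (\<lambda>z. ennreal (1 / - z))) A \<noteq> 0"
proof
  assume "emeasure (density transported (\<lambda>z. ennreal (1 / - z))) A = 0"
  then have "A \<in> null_sets (density transported (\<lambda>z. ennreal (1 / - z)))"
    using assms by (auto simp: null_sets_def)
  then have "AE z in transported. z \<in> A \<longrightarrow> ennreal (1 / - z) = 0"
    by (subst (asm) null_sets_density_iff) auto
  with AE_transported have "AE z in transported. z \<notin> A"
    by eventually_elim (auto simp: ennreal_eq_0_iff field_simps)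
  then have "emeasure transported A = 0"
    by (intro emeasure_eq_0_if_AE_notin) auto
  with assms show False by simp
qed

lemma emeasure_transported_density_null:
  assumes "AE z in transported. z \<notin> A"
  shows "emeasure (density transported (\<lambda>z. ennreal (1 / - z))) A = 0"
  using assms by (intro emeasure_eq_0_if_AE_notin) (auto simp: AE_density elim: eventually_mono)

lemma plus_part_glued: "plus_part glued = N"
proof (rule measure_eqI)
  show *: "sets (plus_part glued) = sets N"
    by (simp add: plus_part_eq_density sets_N)
  fix A assume "A \<in> sets (plus_part glued)"
  then have A: "A \<in> sets borel" using * by (simp add: sets_N)
  have "emeasure (density transported (\<lambda>z. ennreal (1 / - z))) (A \<inter> {0..}) = 0"
    using AE_transported by (intro emeasure_transported_density_null) (auto elim: eventually_mono)
  moreover have "emeasure N (A \<inter> {0..}) = emeasure N A"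
    by (rule emeasure_eq_AE) (use AE_N A in \<open>auto simp: sets_N elim: eventually_mono\<close>)
  ultimately show "emeasure (plus_part glued) A = emeasure N A"
    using A by (simp add: emeasure_plus_part emeasure_glued)
qed

text \<open>The weight \<open>- z\<close> cancels the density \<open>1 / - z\<close> of the
  transported part and annihilates \<open>N\<close>, which lives on positive numbers.\<close>

lemma neg_mass_glued: "neg_mass glued = transported"
proof (rule measure_eqI)
  fix A assume "A \<in> sets (neg_mass glued)"
  then have [measurable]: "A \<in> sets borel" by simp
  have "emeasure (neg_mass glued) A = (\<integral>\<^sup>+z. ennreal (- z) * indicator A z \<partial>glued)"
    unfolding neg_mass_def by (subst emeasure_density) auto
  also have "\<dots> = (\<integral>\<^sup>+z. ennreal (- z) * indicator A z \<partial>N) +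
      (\<integral>\<^sup>+z. ennreal (1 / - z) * (ennreal (- z) * indicator A z) \<partial>transported)"
    by (rule nn_integral_glued) measurable
  also have "(\<integral>\<^sup>+z. ennreal (- z) * indicator A z \<partial>N) = (\<integral>\<^sup>+z. 0 \<partial>N)"
    by (rule nn_integral_cong_AE, use AE_N in eventually_elim) (simp add: ennreal_neg)
  also have "(\<integral>\<^sup>+z. ennreal (1 / - z) * (ennreal (- z) * indicator A z) \<partial>transported) =
      (\<integral>\<^sup>+z. indicator A z \<partial>transported)"
    by (rule nn_integral_cong_AE, use AE_transported in eventually_elim)
      (auto simp flip: mult.assoc ennreal_mult')
  also have "\<dots> = emeasure transported A" by simp
  finally show "emeasure (neg_mass glued) A = emeasure transported A" by simp
qed simp

lemma G_glued_nonneg: "0 \<le> x \<Longrightarrow> G glued x = G N x"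
  using G_plus_part[of glued x] by (simp add: plus_part_glued)

lemma G_glued_s: "0 \<le> x \<Longrightarrow> s x \<le> 0 \<Longrightarrow> G glued (s x) = G N x"
  by (simp add: G_neg_mass neg_mass_glued emeasure_transported_atLeast)

lemma s_bounds: "0 \<le> x \<Longrightarrow> a \<le> s x \<and> s x \<le> 0"
  using s_le_iff[of b x] s_le_iff[of x 0] s_above s_b s_0 a_neg b_pos by (cases "x \<le> b") auto

text \<open>Neither summand charges the complement of the closed interval. Inside it, nonnegative
  points are covered by the support of \<open>N\<close>. At a negative point the strict monotonicity
  of \<open>s\<close> and of \<open>G N\<close> yields transported mass immediately to its
  right.\<close>

lemma supp_glued: "supp glued = {x. a \<le> ereal x \<and> ereal x \<le> b}" (is "_ = ?C")
proof
  have "closed ?C"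
    by (intro closed_Collect_conj closed_Collect_le continuous_intros)
  then have op: "open (- ?C)" by (rule open_Compl)
  then have [measurable]: "- ?C \<in> sets borel" by simp
  have "AE z in N. z \<notin> - ?C"
    using AE_N
  proof eventually_elim
    case (elim z)
    then have "0 < ereal z" by simp
    with a_neg have "a < ereal z" by (rule order_less_trans)
    with elim show ?case by auto
  qed
  then have 1: "emeasure N (- ?C) = 0"
    by (intro emeasure_eq_0_if_AE_notin) auto
  have "AE z in transported. z \<notin> - ?C"
    using AE_transported
  proof eventually_elim
    case (elim z)
    then have "ereal z < 0" by simp
    with b_pos have "ereal z < b" by (rule order_less_trans[rotated])
    with elim show ?case by auto
  qed
  then have "emeasure (density transported (\<lambda>z. ennreal (1 / - z))) (- ?C) = 0"
    by (rule emeasure_transported_density_null)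
  then have "emeasure glued (- ?C) = 0"
    using 1 by (subst emeasure_glued) simp_all
  then show "supp glued \<subseteq> ?C"
    using op by (force simp: supp_def)
next
  show "?C \<subseteq> supp glued"
    unfolding supp_def
  proof (intro subsetI CollectI allI impI, elim conjE)
    fix x U assume x: "x \<in> ?C" and U: "open U" "x \<in> U"
    have U_meas: "U \<in> sets borel" using U by simp
    show "0 < emeasure glued U"
    proof (cases "0 \<le> x")
      case True
      then have "0 < emeasure N U" using U x supp_N by (auto simp: supp_def)
      then show ?thesis by (simp add: emeasure_glued[OF U_meas] add_pos_nonneg)
    next
      case False
      obtain e where e: "0 < e" "{x<..<x + e} \<subseteq> U"
      proof -
        obtain e where "0 < e" "ball x e \<subseteq> U" using U open_contains_ball by blast
        then show ?thesis by (intro that[of e]) (auto simp: subset_eq dist_real_def)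
      qed
      \<comment> \<open>The cap at \<open>0\<close> keeps \<open>y\<close> in the range of
        \<open>s\<close>, so that \<open>s_onto\<close> provides \<open>q\<close>.\<close>
      define y where "y = min 0 (x + e)"
      have y: "x < y" "y \<le> 0" "{x<..<y} \<subseteq> U" using e False by (auto simp: y_def)
      have "a \<le> ereal y" using x y(1) order_trans[of a "ereal x" "ereal y"] by auto
      then obtain q where q: "q \<in> {0..b}" "s q = ereal y"
        by (rule s_onto) (use y in auto)
      obtain p where p: "p \<in> {0..b}" "s p = ereal x"
        by (rule s_onto[of "ereal x"]) (use x False in auto)
      have "q < p"
        using s_le_iff[OF q(1) p(1)] p q y by (simp add: not_le[symmetric])
      moreover have "strict_mono_on {0..b} (G N)"
        by (rule G_strict_mono_on[OF sets_N G_finite]) (simp add: supp_N)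
      ultimately have "G N q < G N p"
        using p q by (auto dest: strict_mono_onD)
      then have "emeasure transported {y..} < emeasure transported {x..}"
        using emeasure_transported_atLeast[of p] emeasure_transported_atLeast[of q] p q
        by (simp add: atLeast_def)
      \<comment> \<open>Since \<open>{x}\<close> is null, \<open>U\<close> must account for the
        excess mass of the half-line from \<open>x\<close> over the one from
        \<open>y\<close>.\<close>
      also have "\<dots> \<le> emeasure transported ({x} \<union> U \<union> {y..})"
      proof (rule emeasure_mono)
        show "{x..} \<subseteq> {x} \<union> U \<union> {y..}"
        proof
          fix z assume "z \<in> {x..}"
          then show "z \<in> {x} \<union> U \<union> {y..}"
            using subsetD[OF y(3), of z] by (cases "z = x \<or> y \<le> z") auto
        qed
      qed (use U in auto)
      also have "\<dots> \<le> emeasure transported {x} + emeasure transported U + emeasure transported {y..}"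
        using U by (intro emeasure_subadditive[THEN order_trans] add_mono) auto
      finally have "emeasure transported U \<noteq> 0"
        by (auto simp: emeasure_transported_singleton)
      then have "emeasure (density transported (\<lambda>z. ennreal (1 / - z))) U \<noteq> 0"
        using U by (intro emeasure_transported_density_pos) auto
      then show ?thesis by (simp add: emeasure_glued[OF U_meas] zero_less_iff_neq_zero)
    qed
  qed
qed

lemma glued_singleton_null: "emeasure glued {x} = 0"
proof -
  have "AE z in transported. z \<notin> {x}"
    by (rule AE_I[of _ _ "{x}"]) (auto simp: emeasure_transported_singleton)
  then have "emeasure (density transported (\<lambda>z. ennreal (1 / - z))) {x} = 0"
    by (rule emeasure_transported_density_null)
  then show ?thesis
    by (simp add: emeasure_glued singleton_null)
qed

text \<open>A push-forward preserves total mass, so the two weighted halves balance.\<close>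

sublocale glued: balanced_measure glued a b
proof
  have "G glued (-\<infinity>) = emeasure transported UNIV"
    by (simp add: G_neg_mass neg_mass_glued)
  also have "\<dots> = G N \<infinity>"
    by (simp add: emeasure_transported G_pos_mass sets_N)
  finally show "G glued (-\<infinity>) = G glued \<infinity>"
    by (simp add: G_glued_nonneg)
qed (use G_finite in \<open>auto simp: glued_singleton_null supp_glued a_neg b_pos G_glued_nonneg\<close>)

lemma recip_glued: "0 \<le> x \<Longrightarrow> recip glued x = s x"
  using s_bounds[of x] by (intro glued.recip_eqI) (auto simp: G_glued_s G_glued_nonneg)

lemma emeasure_glued_UNIV: "emeasure glued UNIV = mass_total"
  by (simp add: emeasure_glued mass_total_def)

lemma represents_glued:
  assumes "mass_total = 1"
  shows "represents a b s N glued"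
proof -
  have "prob_space glued"
    by standard (simp add: space_borel emeasure_glued_UNIV assms)
  moreover from this have "nonatomic glued"
    by (intro nonatomicI_singleton) (auto simp: glued_singleton_null prob_space_def)
  ultimately show ?thesis
    using glued.G_balanced glued.G_finite
    by (auto simp: represents_def zero_mean_iff_G supp_glued plus_part_glued recip_glued)
qed

end

section \<open>Necessity of the conditions and reconstruction of the measure\<close>

context balanced_measure
begin

text \<open>The delicate point is \<open>0\<close>, where the support of \<open>M\<close> could a
  priori owe its mass to the negative side only.\<close>

lemma supp_plus_part: "supp (plus_part M) = {x. 0 \<le> x \<and> ereal x \<le> b}" (is "_ = ?C")
proof
  note plus = emeasure_plus_part[OF sets_M]
  show "supp (plus_part M) \<subseteq> ?C"
  proof
    fix x assume x: "x \<in> supp (plus_part M)"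
    have notin: "x \<notin> U" if "open U" "emeasure M (U \<inter> {0..}) = 0" for U
      using that x plus[of U] by (auto simp: supp_def)
    have "open {z. b < ereal z}"
      by (intro open_Collect_less continuous_intros)
    moreover have "emeasure M ({z. b < ereal z} \<inter> {0..}) = 0"
      using AE_le_b by (intro emeasure_eq_0_if_AE_notin) (auto elim!: eventually_mono)
    ultimately have "x \<notin> {z. b < ereal z}" by (rule notin)
    moreover have "{..<0::real} \<inter> {0..} = {}" by auto
    then have "x \<notin> {..<0}" by (intro notin) auto
    ultimately show "x \<in> ?C" by auto
  qed
  show "?C \<subseteq> supp (plus_part M)"
    unfolding supp_def
  proof (intro subsetI CollectI allI impI, elim conjE)
    fix x U assume x: "x \<in> ?C" and U: "open U" "x \<in> U"
    \<comment> \<open>A positive support point in \<open>U\<close> makes \<open>U\<close> without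
      its nonpositive part an open set of positive mass; near \<open>0\<close> it exists because
      \<open>b\<close> is positive.\<close>
    have "\<exists>y. y \<in> U \<inter> {0<..} \<and> y \<in> supp M"
    proof (cases "x = 0")
      case False
      then show ?thesis using x U a_neg order_trans[of a 0 "ereal x"]
        by (intro exI[of _ x]) (auto simp: supp_M)
    next
      case True
      obtain e where e: "0 < e" "ball x e \<subseteq> U" using U open_contains_ball by blast
      have "0 < min b (ereal e)" using e b_pos by simp
      then obtain y where y: "0 < ereal y" "ereal y < min b (ereal e)"
        using ereal_dense2 by blast
      then show ?thesis using e True a_neg order_trans[of a 0 "ereal y"]
        by (intro exI[of _ y]) (auto simp: supp_M subset_eq dist_real_def)
    qed
    then have "0 < emeasure M (U \<inter> {0<..})"
      using U unfolding supp_def by (auto simp: open_Int)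
    also have "\<dots> \<le> emeasure M (U \<inter> {0..})"
      using U by (intro emeasure_mono) (auto simp: sets_M)
    finally show "0 < emeasure (plus_part M) U"
      using U by (simp add: plus)
  qed
qed

lemma transport:
  assumes s: "\<forall>x\<in>{0..\<infinity>}. recip M x = s x"
  shows "decreasing_transport (plus_part M) a b s"
proof
  show "sets (plus_part M) = sets borel"
    by (simp add: plus_part_eq_density sets_M)
  show "emeasure (plus_part M) {x} = 0" for x
  proof -
    have "emeasure M ({x} \<inter> {0..}) \<le> emeasure M {x}"
      by (rule emeasure_mono) (auto simp: sets_M)
    then show ?thesis by (simp add: emeasure_plus_part sets_M singleton_null)
  qed
  have "{..<0::real} \<inter> {0..} = {}" by auto
  then show "emeasure (plus_part M) {..<0} = 0"
    by (simp add: emeasure_plus_part sets_M)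
  show "G (plus_part M) \<infinity> < \<infinity>"
    using G_finite by (simp add: G_plus_part sets_M)
  show "supp (plus_part M) = {x. 0 \<le> x \<and> ereal x \<le> b}" by (rule supp_plus_part)
  show "s 0 = 0" using s recip_0 by auto
  show "strict_antimono_on {0..b} s"
    using strict_antimono_recip s by (simp add: monotone_on_def)
  show "continuous_on {0..\<infinity>} s"
    using continuous_recip by (rule continuous_on_eq) (use s in blast)
  show "\<forall>x\<in>{b..\<infinity>}. s x = a"
    using recip_above s b_pos by fastforce
qed (use a_neg b_pos in auto)

text \<open>On each half-line from a point \<open>y \<le> 0\<close>, \<open>neg_mass M\<close> has
  mass \<open>G M y\<close>. Choosing \<open>x\<close> with \<open>s x = y\<close> turns this into
  \<open>G M x\<close>, which is the transported mass. Half-lines determine a finite measure, and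
  \<open>emeasure_decompose\<close> then recovers \<open>M\<close>.\<close>

lemma eq_glued:
  assumes s: "\<forall>x\<in>{0..\<infinity>}. recip M x = s x"
  shows "M = decreasing_transport.glued (plus_part M) s"
proof -
  interpret T: decreasing_transport "plus_part M" a b s by (rule transport) fact
  have neg_null: "emeasure (neg_mass M) {x} = 0" for x
  proof -
    have "AE z in M. z \<noteq> x"
      by (rule AE_I[of _ _ "{x}"]) (auto simp: singleton_null sets_M)
    then have "AE z in neg_mass M. z \<noteq> x"
      unfolding neg_mass_def by (subst AE_density) (auto simp: measurable_cong_sets[OF sets_M refl])
    then show ?thesis
      by (intro emeasure_eq_0_if_AE_notin) simp
  qed
  have atLeast: "emeasure (neg_mass M) {y..} = emeasure T.transported {y..}" if y: "y \<le> 0" for y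
  proof -
    \<comment> \<open>Below \<open>a\<close> there is no further mass, so \<open>y\<close> may be
      raised to \<open>a\<close>, which brings it into the range of \<open>s\<close>.\<close>
    obtain x where x: "x \<in> {0..b}" "s x = max a (ereal y)"
      by (rule T.s_onto[of "max a (ereal y)"]) (use a_neg y in auto)
    have "emeasure (neg_mass M) {y..} = G M (ereal y)"
      using y by (simp add: G_neg_mass sets_M atLeast_def)
    also have "\<dots> = G M (max a (ereal y))"
      using G_below[of "ereal y"] by (auto simp: max_def)
    also have "\<dots> = G M x"
      using x recip_props(3)[of x] s by simp
    also have "\<dots> = emeasure T.transported {z. s x \<le> ereal z}"
      using x by (subst T.emeasure_transported_atLeast) (auto simp: G_plus_part sets_M)
    also have "\<dots> = emeasure T.transported {y..}"
      by (rule emeasure_eq_AE) (use T.AE_transported x in \<open>auto elim!: eventually_mono\<close>)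
    finally show ?thesis .
  qed
  have "neg_mass M = T.transported"
  proof (rule measure_eqI_lessThan)
    \<comment> \<open>The uniqueness criterion uses open half-lines; without point masses closed
      ones have the same measure.\<close>
    have split: "emeasure K {y..} = emeasure K {y<..}" if "sets K = sets borel" "emeasure K {y} = 0" for K and y :: real
    proof -
      have "{y..} = insert y {y<..}" by auto
      moreover have "emeasure K (insert y {y<..}) = emeasure K {y} + emeasure K {y<..}"
        by (rule emeasure_insert) (auto simp: that(1))
      ultimately show ?thesis using that(2) by simp
    qed
    fix y
    show "emeasure (neg_mass M) {y<..} < \<infinity>"
    proof -
      have "emeasure (neg_mass M) {y<..} \<le> emeasure (neg_mass M) UNIV"
        by (rule emeasure_mono) (auto simp: sets_M)
      also have "\<dots> = G M (-\<infinity>)" by (simp add: G_neg_mass sets_M)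
      finally show ?thesis using G_finite G_balanced by (simp add: order_le_less_trans)
    qed
    show "emeasure (neg_mass M) {y<..} = emeasure T.transported {y<..}"
    proof (cases "y \<le> 0")
      case True
      then show ?thesis
        using atLeast[OF True] by (simp add: split sets_M neg_null T.emeasure_transported_singleton)
    next
      case False
      \<comment> \<open>For positive \<open>y\<close> both sides vanish: the transported measure
        does not charge \<open>[0,\<infinity>)\<close>, and by \<open>atLeast\<close> at
        \<open>0\<close> neither does \<open>neg_mass M\<close>.\<close>
      have "AE z in T.transported. z \<notin> {0..}"
        using T.AE_transported by eventually_elim auto
      then have "emeasure T.transported {0..} = 0"
        by (rule emeasure_eq_0_if_AE_notin)
      moreover from this atLeast[of 0] have "emeasure (neg_mass M) {0..} = 0" by simp
      moreover have "{y<..} \<subseteq> {0..}" using False by auto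
      ultimately show ?thesis
        using emeasure_mono[of "{y<..}" "{0..}" "neg_mass M"] emeasure_mono[of "{y<..}" "{0..}" T.transported]
        by (simp add: sets_M)
    qed
  qed (simp_all add: sets_M)
  then show ?thesis
    by (intro measure_eqI) (auto simp: sets_M T.emeasure_glued emeasure_decompose[OF sets_M])
qed

end

theorem proposition3p33:
  fixes a_minus a_plus :: ereal
    and s :: "ereal \<Rightarrow> ereal"
    and \<nu> :: "real measure"
  assumes "a_minus < 0" and "0 < a_plus"
    and "sets \<nu> = sets borel" and "finite_measure \<nu>" and "nonatomic \<nu>"
  shows "((\<exists>\<mu>. represents a_minus a_plus s \<nu> \<mu>) \<longleftrightarrow> admissible a_minus a_plus s \<nu>) \<and>
         (admissible a_minus a_plus s \<nu> \<longrightarrow> (\<exists>!\<mu>. represents a_minus a_plus s \<nu> \<mu>))"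
proof -
  have transport: "decreasing_transport \<nu> a_minus a_plus s" if "admissible a_minus a_plus s \<nu>"
    using that assms nonatomic_singleton[OF assms(5)]
    by (intro decreasing_transport.intro) (auto simp: admissible_def)
  have exist: "represents a_minus a_plus s \<nu> (decreasing_transport.glued \<nu> s)"
    if adm: "admissible a_minus a_plus s \<nu>"
  proof -
    interpret decreasing_transport \<nu> a_minus a_plus s by (rule transport) fact
    have "enn2ereal mass_total = 1"
      using adm by (simp add: admissible_def ext_integral_quot)
    then have "mass_total = 1"
      by (metis enn2ereal_inject one_ennreal.rep_eq)
    then show ?thesis by (rule represents_glued)
  qed
  have balanced: "balanced_measure \<mu> a_minus a_plus" if "represents a_minus a_plus s \<nu> \<mu>" for \<mu>
    using that assms nonatomic_singleton[of \<mu>]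
    by (intro balanced_measure.intro) (auto simp: represents_def zero_mean_iff_G)
  \<comment> \<open>The glued measure is built from \<open>\<nu>\<close> and \<open>s\<close> alone,
    so this identity is the uniqueness claim.\<close>
  have unique: "\<mu> = decreasing_transport.glued \<nu> s" if "represents a_minus a_plus s \<nu> \<mu>" for \<mu>
    using balanced_measure.eq_glued[OF balanced[OF that], of s] that by (simp add: represents_def)
  have admissible: "admissible a_minus a_plus s \<nu>" if rep: "represents a_minus a_plus s \<nu> \<mu>" for \<mu>
  proof -
    interpret T: decreasing_transport \<nu> a_minus a_plus s
      using balanced_measure.transport[OF balanced[OF rep], of s] rep by (simp add: represents_def)
    interpret prob_space \<mu> using rep by (simp add: represents_def)
    \<comment> \<open>The probability measure \<open>\<mu>\<close> coincides with the glued measure,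
      whose total mass is the integral in (II).\<close>
    have "emeasure T.glued UNIV = 1"
      using emeasure_space_1 rep unique[OF rep] by (simp add: space_borel)
    then have "ext_integral \<nu> {0<..} (\<lambda>x. 1 - quot x (s (ereal x))) = 1"
      by (simp add: T.ext_integral_quot T.emeasure_glued_UNIV one_ennreal.rep_eq)
    then show ?thesis
      unfolding admissible_def
      using T.s_0 T.neg_null T.G_finite T.s_antimono T.s_continuous T.supp_N T.s_above by blast
  qed
  show ?thesis
    using exist unique admissible by blast
qed

end
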